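(* Let $\{P_m\}_{m=1}^\infty$ be any sequence of quadratic polynomials associated, as described in the context, with a sequence $\{c_k\}_{k=1}^\infty$ of complex numbers with $|c_k|>4$ for all $k$ and a sequence $\{m_k\}_{k=1}^\infty$ of positive integers with $2^{2^{m_k}}\ge 2\sqrt{|c_k|}$ for all $k$. Then for each $m\ge 0$ the Hausdorff dimension of $\mathcal{J}_m$ satisfies $\mathrm{HD}(\mathcal{J}_m)\le 1$.
   Context: Setup. Let $\{c_k\}_{k=1}^\infty$ be complex numbers with $|c_k|>4$ for every $k$, and let $\{m_k\}_{k=1}^\infty$ be positive integers with $2^{2^{m_k}}\ge 2\sqrt{|c_k|}$ for every $k\ge 1$. Put $M_0=0$ and $M_k=\sum_{j=1}^k (m_j+1)$ for $k\ge 1$. Define $P_m(z)=z^2+c_k$ if $m=M_k$ for some $k\ge 1$, and $P_m(z)=z^2$ for all other $m\ge 1$. Compositions. For $0\le m\le n$, $Q_{m,n}=P_n\circ\cdots\circ P_{m+2}\circ P_{m+1}$, with $Q_{m,m}=\mathrm{Id}$. Iterated Fatou and Julia sets. For $m\ge 0$, $\mathcal{F}_m$ is the set of $z\in\widehat{\mathbb{C}}$ such that the family $\{Q_{m,n}\}_{n=m}^\infty$ (viewed as maps $\widehat{\mathbb C}\to\widehat{\mathbb C}$, with the spherical topology) is normal on some neighbourhood of $z$, and $\mathcal{J}_m=\widehat{\mathbb{C}}\setminus\mathcal{F}_m$. $\mathrm{HD}$ denotes Hausdorff dimension. *)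

theory Defs
  imports "HOL-Analysis.Analysis" "HOL-Computational_Algebra.Polynomial"
begin

datatype riemann_sphere = Fin complex | Infty

text \<open>Inverse stereographic projection onto the unit sphere of \<open>\<complex> \<times> \<real>\<close>;
  pulling back the Euclidean distance gives the chordal metric on the sphere.\<close>

fun stereo :: "riemann_sphere \<Rightarrow> complex \<times> real" where
  "stereo (Fin z) = ((2 / (1 + (cmod z)\<^sup>2)) *\<^sub>R z, ((cmod z)\<^sup>2 - 1) / (1 + (cmod z)\<^sup>2))"
| "stereo Infty = (0, 1)"

lemma one_plus_cmod_pos: "0 < 1 + (cmod z)\<^sup>2"
  by (simp add: add_pos_nonneg)

lemma stereo_inj: "stereo x = stereo y \<longleftrightarrow> x = y"
proof
  have fin: "((cmod z)\<^sup>2 - 1) / (1 + (cmod z)\<^sup>2) = 1 - 2 / (1 + (cmod z)\<^sup>2)" for z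
    using one_plus_cmod_pos[of z] by (simp add: field_simps)
  assume eq: "stereo x = stereo y"
  show "x = y"
  proof (cases x; cases y)
    fix z w assume x: "x = Fin z" and y: "y = Fin w"
    have "2 / (1 + (cmod z)\<^sup>2) = 2 / (1 + (cmod w)\<^sup>2)"
      using eq by (simp add: x y fin)
    moreover have "2 / (1 + (cmod z)\<^sup>2) \<noteq> 0"
      using one_plus_cmod_pos[of z] by simp
    ultimately show ?thesis
      using eq by (simp add: x y)
  qed (use eq fin one_plus_cmod_pos in \<open>auto simp: less_imp_neq[symmetric]\<close>)
qed simp

instantiation riemann_sphere :: metric_space
begin

definition dist_riemann_sphere :: "riemann_sphere \<Rightarrow> riemann_sphere \<Rightarrow> real" where
  "dist_riemann_sphere x y = dist (stereo x) (stereo y)"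

definition uniformity_riemann_sphere :: "(riemann_sphere \<times> riemann_sphere) filter" where
  "uniformity_riemann_sphere = (INF e\<in>{0<..}. principal {(x, y). dist x y < e})"

definition open_riemann_sphere :: "riemann_sphere set \<Rightarrow> bool" where
  "open_riemann_sphere U \<longleftrightarrow> (\<forall>x\<in>U. eventually (\<lambda>(x', y). x' = x \<longrightarrow> y \<in> U) uniformity)"

instance
proof
  show "dist x y = 0 \<longleftrightarrow> x = y" for x y :: riemann_sphere
    by (simp add: dist_riemann_sphere_def stereo_inj)
  show "dist x y \<le> dist x z + dist y z" for x y z :: riemann_sphere
    unfolding dist_riemann_sphere_def by (rule dist_triangle2)
qed (fact uniformity_riemann_sphere_def open_riemann_sphere_def)+

end

lemma dist_Fin_Infty: "dist (Fin z) Infty = 2 / sqrt (1 + (cmod z)\<^sup>2)"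
proof -
  let ?a = "1 + (cmod z)\<^sup>2"
  have a: "?a > 0" by (rule one_plus_cmod_pos)
  have "(dist (Fin z) Infty)\<^sup>2 = (2 * cmod z / ?a)\<^sup>2 + (2 / ?a)\<^sup>2"
  proof -
    have "((cmod z)\<^sup>2 - 1) / ?a - 1 = - (2 / ?a)"
      using a by (simp add: field_simps)
    then show ?thesis
      using a by (simp add: dist_riemann_sphere_def dist_norm norm_Pair power_divide)
  qed
  also have "\<dots> = 4 * ?a / ?a\<^sup>2"
    by (simp add: power_divide power_mult_distrib add_divide_distrib[symmetric])
  also have "\<dots> = (2 / sqrt ?a)\<^sup>2"
  proof -
    have "4 * ?a / ?a\<^sup>2 = 4 / ?a"
      using a by (simp add: power2_eq_square del: distrib_left_numeral)
    also have "\<dots> = (2 / sqrt ?a)\<^sup>2"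
      using a by (simp add: power_divide)
    finally show ?thesis .
  qed
  finally show ?thesis
    using a by (simp add: power2_eq_iff_nonneg)
qed

lemma dist_Fin_Fin:
  "dist (Fin z) (Fin w) = 2 * cmod (z - w) / (sqrt (1 + (cmod z)\<^sup>2) * sqrt (1 + (cmod w)\<^sup>2))"
proof -
  let ?a = "1 + (cmod z)\<^sup>2" and ?b = "1 + (cmod w)\<^sup>2"
  have a: "?a > 0" and b: "?b > 0" by (rule one_plus_cmod_pos)+
  have sq: "(cmod u)\<^sup>2 = (Re u)\<^sup>2 + (Im u)\<^sup>2" for u
    by (rule cmod_power2)
  have third: "((cmod z)\<^sup>2 - 1) / ?a - ((cmod w)\<^sup>2 - 1) / ?b = 2 / ?b - 2 / ?a"
    using a b by (simp add: field_simps)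
  have "(dist (Fin z) (Fin w))\<^sup>2
      = (cmod ((2 / ?a) *\<^sub>R z - (2 / ?b) *\<^sub>R w))\<^sup>2 + (2 / ?b - 2 / ?a)\<^sup>2"
    by (simp add: dist_riemann_sphere_def dist_norm norm_Pair third)
  also have "\<dots> = (2 / ?a)\<^sup>2 * ?a + (2 / ?b)\<^sup>2 * ?b
      - 2 * (2 / ?a) * (2 / ?b) * (1 + (Re z * Re w + Im z * Im w))"
  proof -
    have "(cmod (p *\<^sub>R z - q *\<^sub>R w))\<^sup>2 + (q - p)\<^sup>2
        = p\<^sup>2 * ?a + q\<^sup>2 * ?b - 2 * p * q * (1 + (Re z * Re w + Im z * Im w))" for p q :: real
      unfolding sq by (simp add: power2_eq_square algebra_simps)
    then show ?thesis .
  qed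
  also have "\<dots> = 4 / (?a * ?b) * (?b + ?a - 2 * (1 + (Re z * Re w + Im z * Im w)))"
  proof -
    have "(2 / x)\<^sup>2 * x + (2 / y)\<^sup>2 * y - 2 * (2 / x) * (2 / y) * t = 4 / (x * y) * (y + x - 2 * t)"
      if "x > 0" "y > 0" for x y t :: real
      using that by (simp add: power2_eq_square field_simps)
    then show ?thesis
      using a b by blast
  qed
  also have "?b + ?a - 2 * (1 + (Re z * Re w + Im z * Im w)) = (cmod (z - w))\<^sup>2"
    unfolding sq by (simp add: power2_eq_square algebra_simps)
  also have "4 / (?a * ?b) * (cmod (z - w))\<^sup>2 = (2 * cmod (z - w) / (sqrt ?a * sqrt ?b))\<^sup>2"
    using a b by (simp add: power_divide power_mult_distrib)
  finally show ?thesis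
    using a b by (simp add: power2_eq_iff_nonneg)
qed

fun sphere_map :: "complex poly \<Rightarrow> riemann_sphere \<Rightarrow> riemann_sphere" where
  "sphere_map p (Fin z) = Fin (poly p z)"
| "sphere_map p Infty = (if degree p = 0 then Fin (coeff p 0) else Infty)"

text \<open>\<open>Q P m n = P\<^sub>n \<circ> \<dots> \<circ> P\<^sub>m\<^sub>+\<^sub>1\<close>, acting on the sphere; \<open>fold\<close> applies the maps of the
  list from left to right, so \<open>P\<^sub>m\<^sub>+\<^sub>1\<close> acts first. \<open>P 0\<close> is never used.\<close>

definition Q :: "(nat \<Rightarrow> complex poly) \<Rightarrow> nat \<Rightarrow> nat \<Rightarrow> riemann_sphere \<Rightarrow> riemann_sphere" where
  "Q P m n = fold (\<lambda>j. sphere_map (P j)) [Suc m..<Suc n]"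

lemma Q_refl: "Q P m m = id"
  by (simp add: Q_def)

lemma Q_Suc: "m \<le> n \<Longrightarrow> Q P m (Suc n) = sphere_map (P (Suc n)) \<circ> Q P m n"
  by (simp add: Q_def)

definition normal_family_on :: "'a::topological_space set \<Rightarrow> ('a \<Rightarrow> 'b::metric_space) set \<Rightarrow> bool" where
  "normal_family_on U \<F> \<longleftrightarrow>
    (\<forall>f :: nat \<Rightarrow> 'a \<Rightarrow> 'b. range f \<subseteq> \<F> \<longrightarrow>
      (\<exists>r g. strict_mono (r :: nat \<Rightarrow> nat) \<and>
        (\<forall>K. compact K \<and> K \<subseteq> U \<longrightarrow> uniform_limit K (\<lambda>i. f (r i)) g sequentially)))"

definition fatou :: "(nat \<Rightarrow> complex poly) \<Rightarrow> nat \<Rightarrow> riemann_sphere set" where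
  "fatou P m = {z. \<exists>U. open U \<and> z \<in> U \<and> normal_family_on U {Q P m n | n. m \<le> n}}"

definition julia :: "(nat \<Rightarrow> complex poly) \<Rightarrow> nat \<Rightarrow> riemann_sphere set" where
  "julia P m = - fatou P m"

text \<open>\<open>(diam U)\<^sup>s\<close> with the conventions that the empty set contributes \<open>0\<close> and that
  \<open>0\<^sup>0 = 1\<close> (whereas \<open>0 powr 0 = 0\<close>). The library's \<open>diameter\<close> is meaningful
  only for bounded sets, hence the value \<open>\<infinity>\<close> for unbounded ones.\<close>

definition diam_pow :: "real \<Rightarrow> 'a::metric_space set \<Rightarrow> ennreal" where
  "diam_pow s U =
    (if U = {} then 0 else if s = 0 then 1
     else if bounded U then ennreal (diameter U powr s) else \<infinity>)"

definition hausdorff_premeasure :: "real \<Rightarrow> real \<Rightarrow> 'a::metric_space set \<Rightarrow> ennreal" where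
  "hausdorff_premeasure s \<delta> A =
    Inf {\<Sum>i. diam_pow s (U i) | U :: nat \<Rightarrow> 'a set.
      A \<subseteq> (\<Union>i. U i) \<and> (\<forall>i. bounded (U i) \<and> diameter (U i) \<le> \<delta>)}"

definition hausdorff_measure :: "real \<Rightarrow> 'a::metric_space set \<Rightarrow> ennreal" where
  "hausdorff_measure s A = (SUP \<delta>\<in>{0<..}. hausdorff_premeasure s \<delta> A)"

definition hausdorff_dim :: "'a::metric_space set \<Rightarrow> ennreal" where
  "hausdorff_dim A = (INF s\<in>{s. 0 \<le> s \<and> hausdorff_measure s A = 0}. ennreal s)"

text \<open>\<open>M\<^sub>k = (m\<^sub>1 + 1) + \<dots> + (m\<^sub>k + 1)\<close>; the values \<open>c 0\<close> and \<open>ms 0\<close> are irrelevant.\<close>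

definition M :: "(nat \<Rightarrow> nat) \<Rightarrow> nat \<Rightarrow> nat" where
  "M ms k = (\<Sum>j = 1..k. ms j + 1)"

text \<open>As \<open>M ms\<close> is strictly increasing, the first clause is consistent.\<close>

definition associated_sequence ::
    "(nat \<Rightarrow> complex) \<Rightarrow> (nat \<Rightarrow> nat) \<Rightarrow> (nat \<Rightarrow> complex poly) \<Rightarrow> bool" where
  "associated_sequence c ms P \<longleftrightarrow>
    (\<forall>k\<ge>1. P (M ms k) = [:c k, 0, 1:]) \<and>
    (\<forall>n\<ge>1. (\<nexists>k. 1 \<le> k \<and> n = M ms k) \<longrightarrow> P n = [:0, 0, 1:])"

end

theory Submission
  imports Defs
begin

text \<open>
  Over one block of times \<open>M\<^sub>k, \<dots>, M\<^sub>k\<^sub>+\<^sub>1\<close> the composition is \<open>z \<mapsto> z\<^sup>N + c\<close> with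
  \<open>c = c\<^sub>k\<^sub>+\<^sub>1\<close> and \<open>N\<close> a power of two.  The circle \<open>|z| = 2\<close> separates two behaviours at the
  times \<open>M\<^sub>k\<close>.

  Outside it orbits escape: the growth condition says \<open>|c| \<le> 2\<^sup>N / 4\<close>, so \<open>|z| \<ge> 2\<close> gives
  \<open>|z\<^sup>N + c| \<ge> (3/4) |z|\<^sup>N \<ge> 6 |z|\<close> because \<open>N \<ge> 4\<close>, and the compositions tend to infinity at a geometric rate that
  does not depend on \<open>z\<close> (\<open>big_block\<close>, \<open>big_later\<close>).  Uniform convergence of the whole sequence
  makes the family normal
  (\<open>normal_family_on_of_uniform_limit\<close>).  Hence a point of the Julia set stays in the closed disc
  of radius 2 at every time \<open>M\<^sub>k\<close>.

  Inside it sets shrink under preimages: since \<open>|c| > 4\<close>, the disc \<open>|w| \<le> 2\<close> avoids the critical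
  value \<open>c\<close> of \<open>z\<^sup>N + c\<close>, so its preimage is the union of \<open>N\<close> univalent branches.  Each has
  derivative of modulus \<open>|w - c|\<^bsup>1/N\<^esup> / (N |w - c|) \<le> 1 / (\<surd>2 N)\<close>.  The \<open>N\<close> branches together
  therefore multiply the total diameter of a cover by at most \<open>1 / \<surd>2\<close>
  (\<open>coverable_preimage_power\<close>).  Pulling the disc back through \<open>l\<close> blocks covers the surviving
  points by finitely many sets of total diameter at most \<open>4 / \<surd>2\<^sup>l\<close>.  So the Julia set is null for
  the one-dimensional Hausdorff measure, which is more than the dimension bound.
\<close>

section \<open>Finite covers of small total diameter\<close>

definition coverable :: "'a::metric_space set \<Rightarrow> real \<Rightarrow> bool" where
  "coverable A d \<longleftrightarrow>
    (\<exists>Us. A \<subseteq> \<Union>(set Us) \<and> (\<forall>U\<in>set Us. bounded U) \<and> sum_list (map diameter Us) \<le> d)"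

lemma coverable_mono: "coverable A d \<Longrightarrow> B \<subseteq> A \<Longrightarrow> d \<le> e \<Longrightarrow> coverable B e"
  unfolding coverable_def by (meson order_trans)

lemma coverable_bounded: "coverable A d \<Longrightarrow> bounded A"
  unfolding coverable_def by (metis List.finite_set bounded_Union bounded_subset)

lemma coverable_self: "bounded A \<Longrightarrow> coverable A (diameter A)"
  unfolding coverable_def by (intro exI[of _ "[A]"]) simp

lemma coverable_Un:
  assumes "coverable A a" "coverable B b"
  shows "coverable (A \<union> B) (a + b)"
proof -
  obtain Us Vs where
    "A \<subseteq> \<Union>(set Us)" "\<forall>U\<in>set Us. bounded U" "sum_list (map diameter Us) \<le> a"
    "B \<subseteq> \<Union>(set Vs)" "\<forall>U\<in>set Vs. bounded U" "sum_list (map diameter Vs) \<le> b"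
    using assms unfolding coverable_def by blast
  then show ?thesis
    unfolding coverable_def by (intro exI[of _ "Us @ Vs"]) auto
qed

lemma coverable_UN:
  assumes "finite I" "\<And>i. i \<in> I \<Longrightarrow> coverable (A i) (a i)"
  shows "coverable (\<Union>i\<in>I. A i) (\<Sum>i\<in>I. a i)"
  using assms
proof (induction I rule: finite_induct)
  case empty
  show ?case unfolding coverable_def by (intro exI[of _ "[]"]) simp
next
  case (insert i I)
  then show ?case by (simp add: coverable_Un)
qed

lemma lipschitz_image_diameter:
  fixes g :: "'a::metric_space \<Rightarrow> 'b::metric_space"
  assumes g: "L-lipschitz_on X g" and X: "bounded X"
  shows "bounded (g ` X)" "diameter (g ` X) \<le> L * diameter X"
proof -
  have L: "0 \<le> L" using g by (rule lipschitz_on_nonneg)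
  have le: "dist (g x) (g y) \<le> L * diameter X" if "x \<in> X" "y \<in> X" for x y
    using lipschitz_onD[OF g that] diameter_bounded_bound[OF X that] L
    by (meson mult_left_mono order_trans)
  show "bounded (g ` X)"
    using le unfolding bounded_def by (metis (no_types, lifting) imageE)
  show "diameter (g ` X) \<le> L * diameter X"
  proof (cases "X = {}")
    case False
    then show ?thesis
      unfolding diameter_def[of "g ` X"] by (auto intro!: cSUP_least le)
  qed simp
qed

lemma coverable_lipschitz_image:
  fixes g :: "'a::metric_space \<Rightarrow> 'b::metric_space"
  assumes A: "coverable A d" and g: "L-lipschitz_on A g"
  shows "coverable (g ` A) (L * d)"
proof -
  obtain Us where Us: "A \<subseteq> \<Union>(set Us)" "\<forall>U\<in>set Us. bounded U" "sum_list (map diameter Us) \<le> d"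
    using A unfolding coverable_def by blast
  have L: "0 \<le> L" using g by (rule lipschitz_on_nonneg)
  \<comment> \<open>A covering set may leave \<open>A\<close>, where \<open>g\<close> need not be Lipschitz, so it is trimmed to \<open>A\<close>.\<close>
  let ?V = "\<lambda>U. g ` (U \<inter> A)"
  have V: "bounded (?V U)" "diameter (?V U) \<le> L * diameter U" if "U \<in> set Us" for U
  proof -
    have b: "bounded (U \<inter> A)" "bounded U" using Us(2) that by (auto intro: bounded_Int)
    have l: "L-lipschitz_on (U \<inter> A) g" using g by (rule lipschitz_on_subset) simp
    show "bounded (?V U)" using lipschitz_image_diameter(1)[OF l b(1)] .
    have "diameter (U \<inter> A) \<le> diameter U" using b(2) by (intro diameter_subset) auto
    then show "diameter (?V U) \<le> L * diameter U"
      using lipschitz_image_diameter(2)[OF l b(1)] L by (meson mult_left_mono order_trans)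
  qed
  have "sum_list (map diameter (map ?V Us)) \<le> (\<Sum>U\<leftarrow>Us. L * diameter U)"
    using V(2) by (auto simp: comp_def intro!: sum_list_mono)
  also have "\<dots> = L * sum_list (map diameter Us)"
    by (simp add: sum_list_const_mult)
  also have "\<dots> \<le> L * d"
    using Us(3) L by (rule mult_left_mono)
  finally have "sum_list (map diameter (map ?V Us)) \<le> L * d" .
  moreover have "g ` A \<subseteq> \<Union>(set (map ?V Us))" using Us(1) by auto
  moreover have "\<forall>W\<in>set (map ?V Us). bounded W" using V(1) by auto
  ultimately show ?thesis
    unfolding coverable_def by blast
qed

lemma hausdorff_measure_1_eq_0:
  fixes A :: "'a::metric_space set"
  assumes cov: "\<And>e. e > 0 \<Longrightarrow> coverable A e"
  shows "hausdorff_measure 1 A = 0"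
proof -
  have "hausdorff_premeasure 1 \<delta> A \<le> ennreal e" if d: "\<delta> > 0" and e: "e > 0" for \<delta> e
  proof -
    \<comment> \<open>A total diameter of at most \<open>\<delta>\<close> also keeps every single diameter below the mesh \<open>\<delta>\<close>.\<close>
    obtain Us where Us: "A \<subseteq> \<Union>(set Us)" "\<forall>U\<in>set Us. bounded U"
        "sum_list (map diameter Us) \<le> min \<delta> e"
      using cov[of "min \<delta> e"] d e unfolding coverable_def by auto
    define V where "V i = (if i < length Us then Us ! i else {})" for i
    have bV: "bounded (V i)" for i using Us(2) by (simp add: V_def)
    have total: "(\<Sum>i<length Us. diameter (V i)) \<le> min \<delta> e"
      using Us(3) by (simp add: V_def sum_list_sum_nth atLeast0LessThan)
    have small: "diameter (V i) \<le> \<delta>" for i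
    proof (cases "i < length Us")
      case True
      then have "diameter (V i) \<le> (\<Sum>i<length Us. diameter (V i))"
        by (intro member_le_sum) (auto intro: diameter_ge_0 bV)
      then show ?thesis using total by simp
    qed (use d in \<open>simp add: V_def\<close>)
    have AV: "A \<subseteq> (\<Union>i. V i)"
    proof
      fix x assume "x \<in> A"
      then obtain U where "U \<in> set Us" "x \<in> U" using Us(1) by blast
      then obtain i where "i < length Us" "x \<in> Us ! i" by (metis in_set_conv_nth)
      then show "x \<in> (\<Union>i. V i)" by (auto simp: V_def intro!: exI[of _ i])
    qed
    have pow: "diam_pow 1 (V i) \<le> ennreal (diameter (V i))" for i
      using bV[of i] diameter_ge_0[OF bV[of i]] by (simp add: diam_pow_def)
    have "hausdorff_premeasure 1 \<delta> A \<le> (\<Sum>i. diam_pow 1 (V i))"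
      unfolding hausdorff_premeasure_def using AV bV small by (intro Inf_lower) blast
    also have "\<dots> = (\<Sum>i<length Us. diam_pow 1 (V i))"
      by (rule suminf_finite) (auto simp: V_def diam_pow_def)
    also have "\<dots> \<le> (\<Sum>i<length Us. ennreal (diameter (V i)))"
      by (intro sum_mono pow)
    also have "\<dots> = ennreal (\<Sum>i<length Us. diameter (V i))"
      by (rule sum_ennreal) (rule diameter_ge_0[OF bV])
    also have "\<dots> \<le> ennreal e"
      using total by (intro ennreal_leI) simp
    finally show ?thesis .
  qed
  then have "hausdorff_premeasure 1 \<delta> A = 0" if "\<delta> > 0" for \<delta>
    using that ennreal_le_epsilon[of 0 "hausdorff_premeasure 1 \<delta> A"] by simp
  then show ?thesis
    unfolding hausdorff_measure_def by (simp add: bot_ennreal[symmetric])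
qed

section \<open>Inverse branches of \<open>z\<^sup>N + c\<close>\<close>

text \<open>
  On the disc \<open>|w| \<le> 2\<close> the quotient \<open>(w - c) / (-c) = 1 - w / c\<close> stays within \<open>1/2\<close> of \<open>1\<close>, so
  its principal \<open>N\<close>-th root is holomorphic there; multiplying by an \<open>N\<close>-th root \<open>\<zeta>\<close> of \<open>-c\<close> gives
  an inverse branch of \<open>z\<^sup>N + c\<close>.
\<close>

definition root_branch :: "complex \<Rightarrow> nat \<Rightarrow> complex \<Rightarrow> complex \<Rightarrow> complex" where
  "root_branch c N \<zeta> w = \<zeta> * exp (Ln (1 - w / c) / of_nat N)"

lemma root_branch_power:
  assumes "N > 0" "\<zeta> ^ N = - c" "c \<noteq> 0" "w \<noteq> c"
  shows "root_branch c N \<zeta> w ^ N = w - c"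
proof -
  have "exp (Ln (1 - w / c) / of_nat N) ^ N = exp (Ln (1 - w / c))"
    using assms(1) by (simp flip: exp_of_nat_mult)
  also have "\<dots> = 1 - w / c" using assms(3,4) by (intro exp_Ln) auto
  finally show ?thesis
    using assms(2,3) by (simp add: root_branch_def power_mult_distrib field_simps)
qed

lemma root_branch_surj:
  assumes "N > 0" "c \<noteq> 0" "z \<noteq> 0"
  obtains \<zeta> where "\<zeta> ^ N = - c" "z = root_branch c N \<zeta> (z ^ N + c)"
proof
  let ?h = "root_branch c N 1 (z ^ N + c)"
  let ?z = "z / ?h"
  have h: "?h \<noteq> 0" by (simp add: root_branch_def)
  have "?h ^ N = exp (Ln (1 - (z ^ N + c) / c))"
    using assms(1) by (simp add: root_branch_def flip: exp_of_nat_mult)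
  also have "\<dots> = - (z ^ N / c)"
    using assms by (subst exp_Ln) (auto simp: field_simps)
  finally show "?z ^ N = - c"
    using assms by (simp add: power_divide)
  show "z = root_branch c N ?z (z ^ N + c)"
    using h by (simp add: root_branch_def)
qed

text \<open>
  With \<open>z\<close> the value of the branch at \<open>w\<close>, its derivative has modulus
  \<open>|z| / (N |w - c|) = |z| / (N |z|\<^sup>N)\<close>, and \<open>|z|\<^sup>N = |w - c| \<ge> 2\<close> forces \<open>\<surd>2 |z| \<le> |z|\<^sup>N\<close>.
\<close>

lemma root_branch_lipschitz:
  assumes c: "cmod c > 4" and N: "N \<ge> 2" and \<zeta>: "\<zeta> ^ N = - c"
  shows "(1 / (sqrt 2 * real N))-lipschitz_on (cball 0 2) (root_branch c N \<zeta>)"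
proof (rule lipschitz_onI)
  let ?g = "root_branch c N \<zeta>"
  let ?g' = "\<lambda>w. ?g w * (- 1 / c / (1 - w / c) / of_nat N)"
  have c0: "c \<noteq> 0" using c by auto
  have der: "(?g has_field_derivative ?g' w) (at w within cball 0 2)" if "w \<in> cball 0 2" for w
  proof -
    have "cmod (w / c) < 1"
      using that c by (simp add: norm_divide divide_simps)
    then have "Re (w / c) < 1"
      using complex_Re_le_cmod[of "w / c"] by linarith
    then have "1 - w / c \<notin> \<real>\<^sub>\<le>\<^sub>0"
      by (auto simp: complex_nonpos_Reals_iff)
    then have "((\<lambda>w. Ln (1 - w / c)) has_field_derivative
        inverse (1 - w / c) * (- (1 / c))) (at w within cball 0 2)"
      by (intro DERIV_chain2[OF has_field_derivative_Ln]) (auto intro!: derivative_eq_intros simp: c0)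
    then have "(?g has_field_derivative \<zeta> * (exp (Ln (1 - w / c) / of_nat N) *
        (inverse (1 - w / c) * (- (1 / c)) / of_nat N))) (at w within cball 0 2)"
      unfolding root_branch_def
      by (intro DERIV_cmult DERIV_chain2[OF DERIV_exp] DERIV_cdivide)
    then show ?thesis
      by (simp add: root_branch_def divide_inverse mult_ac)
  qed
  have bound: "cmod (?g' w) \<le> 1 / (sqrt 2 * real N)" if "w \<in> cball 0 2" for w
  proof -
    have wc: "cmod (w - c) \<ge> 2"
      using that c norm_triangle_ineq2[of c w] by (simp add: norm_minus_commute)
    then have w: "w \<noteq> c" by auto
    let ?r = "cmod (?g w)"
    have pow: "?r ^ N = cmod (w - c)"
      using root_branch_power[OF _ \<zeta> c0 w] N by (simp flip: norm_power)
    have "?r \<ge> 1"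
    proof (rule ccontr)
      assume "\<not> ?r \<ge> 1"
      then have "?r ^ N \<le> 1" by (intro power_le_one) auto
      then show False using pow wc by simp
    qed
    have "2 * ?r ^ 2 \<le> ?r ^ N * ?r ^ N"
    proof (rule mult_mono)
      show "?r ^ 2 \<le> ?r ^ N" using N \<open>?r \<ge> 1\<close> by (rule power_increasing)
    qed (use wc pow in auto)
    then have "(sqrt 2 * ?r) ^ 2 \<le> (?r ^ N) ^ 2"
      by (simp add: power_mult_distrib power2_eq_square[of "cmod (root_branch c N \<zeta> w) ^ N"])
    then have le: "sqrt 2 * ?r \<le> cmod (w - c)"
      unfolding pow by (rule power2_le_imp_le) simp
    have "- 1 / c / (1 - w / c) = 1 / (w - c)"
      using c0 w by (simp add: field_simps)
    then have "cmod (?g' w) = ?r / (cmod (w - c) * real N)"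
      by (simp add: norm_mult norm_divide)
    also have "\<dots> \<le> 1 / (sqrt 2 * real N)"
      using le wc N by (simp add: divide_simps mult_ac)
    finally show ?thesis .
  qed
  show "dist (?g x) (?g y) \<le> 1 / (sqrt 2 * real N) * dist x y" if "x \<in> cball 0 2" "y \<in> cball 0 2" for x y
    unfolding dist_norm
    by (rule field_differentiable_bound[OF convex_cball der bound that(1,2)])
qed simp

text \<open>
  The \<open>N\<close> branches each contribute \<open>d / (\<surd>2 N)\<close>.  This cancellation of \<open>N\<close> is why the exponent
  one works whatever the degrees are.
\<close>

lemma coverable_preimage_power:
  assumes c: "cmod c > 4" and N: "N \<ge> 2" and A: "A \<subseteq> cball 0 2" and cov: "coverable A d"
  shows "coverable {z. z ^ N + c \<in> A} (d / sqrt 2)"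
proof -
  let ?Z = "{\<zeta>. \<zeta> ^ N = - c}"
  have c0: "c \<noteq> 0" and N0: "N > 0" using c N by auto
  have fin: "finite ?Z" using N0 by (rule finite_nth_roots)
  have "coverable (\<Union>\<zeta>\<in>?Z. root_branch c N \<zeta> ` A) (\<Sum>\<zeta>\<in>?Z. 1 / (sqrt 2 * real N) * d)"
    using fin A by (intro coverable_UN coverable_lipschitz_image[OF cov])
      (auto intro: lipschitz_on_subset[OF root_branch_lipschitz[OF c N]])
  moreover have "(\<Sum>\<zeta>\<in>?Z. 1 / (sqrt 2 * real N) * d) = d / sqrt 2"
    using card_nth_roots[of "- c" N] c0 N0 by simp
  moreover have "{z. z ^ N + c \<in> A} \<subseteq> (\<Union>\<zeta>\<in>?Z. root_branch c N \<zeta> ` A)"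
  proof
    fix z assume z: "z \<in> {z. z ^ N + c \<in> A}"
    \<comment> \<open>The critical point \<open>0\<close> is sent to \<open>c\<close>, outside \<open>A\<close>.\<close>
    have "z \<noteq> 0" using z A c N0 by (auto simp: subset_iff power_0_left)
    then obtain \<zeta> where "\<zeta> ^ N = - c" "z = root_branch c N \<zeta> (z ^ N + c)"
      using root_branch_surj N0 c0 by blast
    then show "z \<in> (\<Union>\<zeta>\<in>?Z. root_branch c N \<zeta> ` A)" using z by blast
  qed
  ultimately show ?thesis by (metis coverable_mono order_refl)
qed

section \<open>Normality of a uniformly convergent sequence, and the finite part of the sphere\<close>

text \<open>
  A sequence chosen from the family either repeats one member infinitely often, and then has a
  constant subsequence, or its indices tend to infinity, and then it inherits the uniform limit.
\<close>

lemma normal_family_on_of_uniform_limit: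
  fixes F :: "nat \<Rightarrow> 'a::topological_space \<Rightarrow> 'b::metric_space"
  assumes lim: "uniform_limit U F g sequentially"
  shows "normal_family_on U (F ` A)"
  unfolding normal_family_on_def
proof (intro allI impI)
  fix f :: "nat \<Rightarrow> 'a \<Rightarrow> 'b" assume "range f \<subseteq> F ` A"
  then have "\<forall>i. \<exists>n. f i = F n" by blast
  then obtain n where n: "\<And>i. f i = F (n i)" by metis
  show "\<exists>r g. strict_mono r \<and>
      (\<forall>K. compact K \<and> K \<subseteq> U \<longrightarrow> uniform_limit K (\<lambda>i. f (r i)) g sequentially)"
  proof (cases "\<exists>v. infinite {i. n i = v}")
    case True
    then obtain v where "infinite {i. n i = v}" by blast
    then obtain r :: "nat \<Rightarrow> nat" where "strict_mono r" "\<And>i. n (r i) = v"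
      using infinite_enumerate by blast
    then show ?thesis
      using n by (intro exI[of _ r] exI[of _ "F v"]) (simp add: uniform_limit_const)
  next
    case False
    have "filterlim n sequentially sequentially"
      unfolding filterlim_at_top
    proof
      fix N
      have "{i. \<not> N \<le> n i} = (\<Union>v<N. {i. n i = v})" by auto
      then have "finite {i. \<not> N \<le> n i}" using False by auto
      then show "\<forall>\<^sub>F i in sequentially. N \<le> n i"
        by (simp add: eventually_cofinite flip: cofinite_eq_sequentially)
    qed
    then have "uniform_limit U (\<lambda>i. f i) g sequentially"
      unfolding n by (rule filterlim_compose[OF lim])
    then show ?thesis
      by (intro exI[of _ id] exI[of _ g])
        (auto intro: uniform_limit_on_subset strict_mono_id)
  qed
qed

lemma Fin_lipschitz: "2-lipschitz_on X Fin"
proof (rule lipschitz_onI)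
  fix z w :: complex
  have "1 \<le> sqrt (1 + (cmod z)\<^sup>2) * sqrt (1 + (cmod w)\<^sup>2)"
    using mult_mono[of 1 "sqrt (1 + (cmod z)\<^sup>2)" 1 "sqrt (1 + (cmod w)\<^sup>2)"] by simp
  then show "dist (Fin z) (Fin w) \<le> 2 * dist z w"
    unfolding dist_Fin_Fin dist_norm
    using mult_left_mono[of 1 _ "2 * cmod (z - w)"] by (simp add: divide_le_eq)
qed simp

section \<open>The blocks of an associated sequence\<close>

text \<open>\<open>big R\<close> is the closed neighbourhood \<open>|z| \<ge> R\<close> of the point at infinity.\<close>

definition big :: "real \<Rightarrow> riemann_sphere \<Rightarrow> bool" where
  "big R x \<longleftrightarrow> (\<forall>z. x = Fin z \<longrightarrow> R \<le> cmod z)"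

lemma big_simps [simp]: "big R (Fin z) \<longleftrightarrow> R \<le> cmod z" "big R Infty"
  by (auto simp: big_def)

lemma big_mono: "big R x \<Longrightarrow> r \<le> R \<Longrightarrow> big r x"
  by (auto simp: big_def)

lemma big_dist:
  assumes "big R x" "R > 0"
  shows "dist x Infty \<le> 2 / R"
proof (cases x)
  case (Fin z)
  then have "R \<le> cmod z" using assms(1) by simp
  also have "\<dots> \<le> sqrt (1 + (cmod z)\<^sup>2)" by (rule real_le_rsqrt) simp
  finally have R: "R \<le> sqrt (1 + (cmod z)\<^sup>2)" .
  with assms(2) have "0 < sqrt (1 + (cmod z)\<^sup>2)" by linarith
  then show ?thesis
    unfolding Fin dist_Fin_Infty using assms(2) R by (intro divide_left_mono mult_pos_pos) auto
qed (use assms(2) in simp)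

lemma Q_comp:
  assumes "m \<le> n" "n \<le> p"
  shows "Q P m p x = Q P n p (Q P m n x)"
  using assms(2)
proof (induction p rule: dec_induct)
  case base
  then show ?case by (simp add: Q_refl)
next
  case (step p)
  then show ?case using assms(1) by (simp add: Q_Suc)
qed

locale associated =
  fixes c :: "nat \<Rightarrow> complex" and ms :: "nat \<Rightarrow> nat" and P :: "nat \<Rightarrow> complex poly"
  assumes c_large: "\<And>k. k \<ge> 1 \<Longrightarrow> cmod (c k) > 4"
    and ms_pos: "\<And>k. k \<ge> 1 \<Longrightarrow> ms k > 0"
    and ms_large: "\<And>k. k \<ge> 1 \<Longrightarrow> (2::real) ^ (2 ^ ms k) \<ge> 2 * sqrt (cmod (c k))"
    and assoc: "associated_sequence c ms P"
begin

lemma M_Suc: "M ms (Suc k) = Suc (M ms k + ms (Suc k))"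
  by (simp add: M_def)

lemma M_strict_mono: "strict_mono (M ms)"
  by (rule strict_mono_Suc_iff[THEN iffD2]) (simp add: M_Suc)

lemma obtain_block:
  obtains k where "M ms k \<le> n" "n < M ms (Suc k)"
proof -
  have "\<exists>k. M ms k \<le> n \<and> n < M ms (Suc k)"
  proof (induction n)
    case 0
    show ?case by (intro exI[of _ 0]) (simp add: M_def)
  next
    case (Suc n)
    then obtain k where k: "M ms k \<le> n" "n < M ms (Suc k)" by blast
    show ?case
    proof (cases "Suc n < M ms (Suc k)")
      case True
      then show ?thesis using k by (intro exI[of _ k]) simp
    next
      case False
      then show ?thesis using k by (intro exI[of _ "Suc k"]) (simp add: M_Suc)
    qed
  qed
  then show ?thesis using that by blast
qed

lemma P_block_end: "P (M ms (Suc k)) = [:c (Suc k), 0, 1:]"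
  using assoc by (simp add: associated_sequence_def)

lemma P_block_inner:
  assumes "M ms k \<le> n" "Suc n < M ms (Suc k)"
  shows "P (Suc n) = [:0, 0, 1:]"
proof -
  have "Suc n \<noteq> M ms j" for j
  proof
    assume "Suc n = M ms j"
    then have "M ms k < M ms j" "M ms j < M ms (Suc k)" using assms by auto
    then have "k < j" "j < Suc k" using strict_mono_less[OF M_strict_mono] by blast+
    then show False by simp
  qed
  then show ?thesis using assoc by (simp add: associated_sequence_def)
qed

lemma P_cases: "P (Suc n) = [:0, 0, 1:] \<or> (\<exists>k. P (Suc n) = [:c k, 0, 1:])"
  using assoc by (cases "\<exists>k\<ge>1. Suc n = M ms k") (auto simp: associated_sequence_def)

lemma Q_Infty: "m \<le> n \<Longrightarrow> Q P m n Infty = Infty"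
proof (induction n rule: dec_induct)
  case base
  show ?case by (simp add: Q_refl)
next
  case (step n)
  then show ?case using P_cases[of n] by (auto simp: Q_Suc)
qed

lemma Q_block_inner:
  assumes "M ms k \<le> m" "m + i < M ms (Suc k)"
  shows "Q P m (m + i) (Fin z) = Fin (z ^ (2 ^ i))"
  using assms(2)
proof (induction i)
  case 0
  show ?case by (simp add: Q_refl)
next
  case (Suc i)
  then have "P (Suc (m + i)) = [:0, 0, 1:]" using assms(1) by (intro P_block_inner) auto
  then show ?case using Suc by (simp add: Q_Suc mult_2 power_add)
qed

lemma Q_block_end:
  assumes "M ms k \<le> m" "m < M ms (Suc k)"
  shows "Q P m (M ms (Suc k)) (Fin z) = Fin (z ^ (2 ^ (M ms (Suc k) - m)) + c (Suc k))"
proof -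
  define i where "i = M ms (Suc k) - Suc m"
  have i: "M ms (Suc k) = Suc (m + i)" using assms(2) by (simp add: i_def)
  have "Q P m (Suc (m + i)) (Fin z) = sphere_map (P (M ms (Suc k))) (Fin (z ^ (2 ^ i)))"
    using Q_block_inner[OF assms(1), of i z] i by (simp add: Q_Suc)
  also have "\<dots> = Fin (z ^ (2 ^ Suc i) + c (Suc k))"
    by (simp add: P_block_end mult_2 power_add add.commute)
  finally show ?thesis using i by simp
qed

section \<open>Escape outside the disc of radius 2\<close>

lemma big_block:
  assumes "big R x" "R \<ge> 2"
  shows "big (6 * R) (Q P (M ms k) (M ms (Suc k)) x)"
proof (cases x)
  case (Fin z)
  let ?c = "c (Suc k)" and ?K = "2 ^ ms (Suc k) :: nat"
  let ?N = "2 * ?K"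
  have z: "R \<le> cmod z" "2 \<le> cmod z" using assms Fin by auto
  have "?K \<ge> 2 ^ 1" using ms_pos[of "Suc k"] by (intro power_increasing) auto
  then have N: "?N \<ge> 4" by simp
  have "(2 * sqrt (cmod ?c))\<^sup>2 \<le> (2 ^ ?K)\<^sup>2"
    using ms_large[of "Suc k"] by (intro power_mono) auto
  also have "\<dots> = 2 ^ ?N" by (simp add: mult.commute flip: power_mult)
  also have "\<dots> \<le> cmod z ^ ?N" using z by (intro power_mono) auto
  finally have c: "4 * cmod ?c \<le> cmod z ^ ?N" by (simp add: power_mult_distrib)
  have "8 * cmod z \<le> cmod z ^ 3 * cmod z"
    using power_mono[OF z(2), of 3] by (intro mult_right_mono) auto
  also have "\<dots> = cmod z ^ 4" by (simp add: eval_nat_numeral)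
  also have "\<dots> \<le> cmod z ^ ?N" using N z by (intro power_increasing) auto
  finally have "6 * cmod z \<le> cmod z ^ ?N - cmod ?c" using c by simp
  also have "\<dots> \<le> cmod (z ^ ?N + ?c)"
    using norm_diff_ineq[of "z ^ ?N" ?c] by (simp add: norm_power)
  finally have "6 * R \<le> cmod (z ^ ?N + ?c)" using z by simp
  moreover have "Q P (M ms k) (M ms (Suc k)) (Fin z) = Fin (z ^ ?N + ?c)"
    by (subst Q_block_end) (auto simp: M_Suc Suc_diff_le)
  ultimately show ?thesis using Fin by simp
qed (use Q_Infty[of "M ms k" "M ms (Suc k)"] in \<open>simp add: M_Suc\<close>)

lemma big_blocks:
  assumes "big 2 x"
  shows "big (2 * 6 ^ j) (Q P (M ms k) (M ms (k + j)) x)"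
proof (induction j)
  case 0
  then show ?case using assms by (simp add: Q_refl)
next
  case (Suc j)
  have le: "M ms k \<le> M ms (k + j)" "M ms (k + j) \<le> M ms (Suc (k + j))"
    by (auto simp: strict_mono_less_eq[OF M_strict_mono])
  have "(2::real) \<le> 2 * 6 ^ j" by simp
  from big_block[OF Suc this, of "k + j"] show ?case
    by (simp flip: Q_comp[OF le])
qed

lemma big_inner:
  assumes "big R x" "R \<ge> 1" "M ms k \<le> n" "n < M ms (Suc k)"
  shows "big R (Q P (M ms k) n x)"
proof (cases x)
  case (Fin z)
  have "Q P (M ms k) n (Fin z) = Fin (z ^ (2 ^ (n - M ms k)))"
    using Q_block_inner[of k "M ms k" "n - M ms k" z] assms by simp
  moreover have "cmod z \<le> cmod z ^ (2 ^ (n - M ms k))"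
    using assms(1,2) Fin by (intro self_le_power) auto
  ultimately show ?thesis using assms(1) Fin by (simp add: norm_power)
qed (use assms Q_Infty in simp)

text \<open>
  Inside a block only \<open>z \<mapsto> z\<^sup>2\<close> is applied, which does not decrease a modulus above 1.  So the
  growth reached at the last completed block persists until the next one is completed.
\<close>

lemma big_later:
  assumes "big 2 x" "M ms (k + j) \<le> n"
  shows "big (2 * 6 ^ j) (Q P (M ms k) n x)"
proof -
  obtain k' where k': "M ms k' \<le> n" "n < M ms (Suc k')" by (rule obtain_block)
  then have "k + j < Suc k'"
    using assms(2) strict_mono_less[OF M_strict_mono, of "k + j" "Suc k'"] by linarith
  then obtain i where i: "k' = k + (j + i)" by (metis add.assoc less_Suc_eq_le le_Suc_ex)
  have le: "M ms k \<le> M ms k'" using i by (simp add: strict_mono_less_eq[OF M_strict_mono])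
  have "big (2 * 6 ^ (j + i)) (Q P (M ms k) (M ms k') x)"
    using big_blocks[OF assms(1), of "j + i" k] i by simp
  moreover have "(1::real) \<le> 2 * 6 ^ (j + i)"
    using one_le_power[of "6::real" "j + i"] by linarith
  ultimately have "big (2 * 6 ^ (j + i)) (Q P (M ms k') n (Q P (M ms k) (M ms k') x))"
    using k' by (rule big_inner)
  then have "big (2 * 6 ^ (j + i)) (Q P (M ms k) n x)"
    by (simp flip: Q_comp[OF le k'(1)])
  then show ?thesis by (rule big_mono) (simp add: power_increasing)
qed

lemma escape_uniform_limit:
  assumes m: "m \<le> M ms k" and U: "\<And>x. x \<in> U \<Longrightarrow> big 2 (Q P m (M ms k) x)"
  shows "uniform_limit U (Q P m) (\<lambda>_. Infty) sequentially"
proof (rule uniform_limitI)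
  fix e :: real assume e: "e > 0"
  obtain j where j: "1 / e < 6 ^ j" using real_arch_pow[of 6 "1 / e"] by auto
  have "dist (Q P m n x) Infty < e" if n: "M ms (k + j) \<le> n" and x: "x \<in> U" for n x
  proof -
    have le: "M ms k \<le> n"
      using n strict_mono_less_eq[OF M_strict_mono, of k "k + j"] by simp
    have "big (2 * 6 ^ j) (Q P m n x)"
      using big_later[OF U[OF x] n] by (simp flip: Q_comp[OF m le])
    then have "dist (Q P m n x) Infty \<le> 2 / (2 * 6 ^ j)" by (rule big_dist) simp
    also have "\<dots> < e" using j e by (simp add: field_simps)
    finally show ?thesis .
  qed
  then show "\<forall>\<^sub>F n in sequentially. \<forall>x\<in>U. dist (Q P m n x) Infty < e"
    by (intro eventually_sequentiallyI) blast
qed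

section \<open>The points that stay in the disc\<close>

text \<open>\<open>survivors l k\<close> are the starting points at time \<open>M\<^sub>k\<close> that lie in the closed disc of radius 2
  at each of the times \<open>M\<^sub>k, \<dots>, M\<^sub>k\<^sub>+\<^sub>l\<close>.\<close>

primrec survivors :: "nat \<Rightarrow> nat \<Rightarrow> complex set" where
  "survivors 0 k = cball 0 2"
| "survivors (Suc l) k =
    {z \<in> cball 0 2. z ^ (2 ^ Suc (ms (Suc k))) + c (Suc k) \<in> survivors l (Suc k)}"

lemma survivors_disc: "survivors l k \<subseteq> cball 0 2"
  by (cases l) auto

lemma closed_preimage_power:
  fixes A :: "complex set"
  assumes "closed A"
  shows "closed {z. z ^ N + b \<in> A}"
proof -
  have "closed ((\<lambda>z. z ^ N + b) -` A)"
    using assms by (intro closed_vimage) (auto intro!: continuous_intros)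
  then show ?thesis by (simp add: vimage_def)
qed

lemma closed_survivors: "closed (survivors l k)"
proof (induction l arbitrary: k)
  case (Suc l)
  show ?case
    unfolding survivors.simps Collect_conj_eq Collect_mem_eq
    by (intro closed_Int closed_cball closed_preimage_power Suc)
qed simp

lemma coverable_survivors: "coverable (survivors l k) (4 / sqrt 2 ^ l)"
proof (induction l arbitrary: k)
  case 0
  show ?case using coverable_self[of "cball (0::complex) 2"] by simp
next
  case (Suc l)
  have "(2::nat) ^ 1 \<le> 2 ^ Suc (ms (Suc k))" by (intro power_increasing) auto
  then have "coverable {z. z ^ (2 ^ Suc (ms (Suc k))) + c (Suc k) \<in> survivors l (Suc k)}
      (4 / sqrt 2 ^ l / sqrt 2)"
    using c_large[of "Suc k"] survivors_disc Suc by (intro coverable_preimage_power) auto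
  then show ?case by (rule coverable_mono) (auto simp: mult.commute)
qed

text \<open>Once an orbit has left the disc at some time \<open>M\<^sub>k\<close>, the growth outside prevents its return.\<close>

lemma big_if_not_survivor:
  assumes "z \<notin> survivors l k"
  shows "big 2 (Q P (M ms k) (M ms (k + l)) (Fin z))"
  using assms
proof (induction l arbitrary: k z)
  case 0
  then show ?case by (simp add: Q_refl)
next
  case (Suc l)
  show ?case
  proof (cases "z \<in> cball 0 2")
    case False
    then have "big 2 (Fin z)" by simp
    have "(1::real) \<le> 6 ^ Suc l" by (rule one_le_power) simp
    then show ?thesis
      using big_blocks[OF \<open>big 2 (Fin z)\<close>, of "Suc l" k] by (auto elim: big_mono)
  next
    case True
    let ?w = "z ^ (2 ^ Suc (ms (Suc k))) + c (Suc k)"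
    have "?w \<notin> survivors l (Suc k)" using Suc.prems True by simp
    then have escapes: "big 2 (Q P (M ms (Suc k)) (M ms (Suc k + l)) (Fin ?w))" by (rule Suc.IH)
    have end_w: "Q P (M ms k) (M ms (Suc k)) (Fin z) = Fin ?w"
      by (subst Q_block_end) (auto simp: M_Suc Suc_diff_le)
    have le: "M ms k \<le> M ms (Suc k)" "M ms (Suc k) \<le> M ms (k + Suc l)"
      by (auto simp: strict_mono_less_eq[OF M_strict_mono])
    show ?thesis
      unfolding Q_comp[OF le] end_w using escapes by simp
  qed
qed

text \<open>
  A starting time \<open>m\<close> inside a block reaches the end of that block by a map \<open>z\<^sup>N + c\<close> with a smaller
  \<open>N\<close>, still at least 2.  So the preimage estimate applies to this first, incomplete block too.
\<close>

lemma coverable_julia: "coverable (julia P m) (8 / sqrt 2 ^ Suc l)"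
proof -
  obtain k where k: "M ms k \<le> m" "m < M ms (Suc k)" by (rule obtain_block)
  define N :: nat where "N = 2 ^ (M ms (Suc k) - m)"
  define K where "K = {z. z ^ N + c (Suc k) \<in> survivors l (Suc k)}"
  have "(2::nat) ^ 1 \<le> N" unfolding N_def using k(2) by (intro power_increasing) auto
  then have "coverable K (4 / sqrt 2 ^ l / sqrt 2)"
    unfolding K_def using c_large[of "Suc k"] survivors_disc coverable_survivors
    by (intro coverable_preimage_power) auto
  then have K: "coverable K (4 / sqrt 2 ^ Suc l)" by (simp add: mult.commute)
  \<comment> \<open>The complement of the image of a compact set is an open neighbourhood of infinity.\<close>
  have "compact K"
    using coverable_bounded[OF K] unfolding compact_eq_bounded_closed K_def
    by (auto intro: closed_preimage_power closed_survivors)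
  then have "compact (Fin ` K)"
    by (intro compact_continuous_image lipschitz_on_continuous_on[OF Fin_lipschitz])
  then have U: "open (- (Fin ` K))" by (simp add: compact_imp_closed open_Compl)
  let ?e = "M ms (Suc k + l)"
  have le: "m \<le> M ms (Suc k)" "M ms (Suc k) \<le> ?e"
    using k by (auto simp: strict_mono_less_eq[OF M_strict_mono])
  have "big 2 (Q P m ?e x)" if x: "x \<in> - (Fin ` K)" for x
  proof (cases x)
    case (Fin z)
    then have "z ^ N + c (Suc k) \<notin> survivors l (Suc k)" using x by (auto simp: K_def)
    from big_if_not_survivor[OF this] show ?thesis
      unfolding Fin Q_comp[OF le] Q_block_end[OF k] N_def .
  next
    case Infty
    have "m \<le> ?e" using le by simp
    then show ?thesis using Infty by (simp add: Q_Infty)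
  qed
  then have "uniform_limit (- (Fin ` K)) (Q P m) (\<lambda>_. Infty) sequentially"
    using le by (intro escape_uniform_limit[of m "Suc k + l"]) auto
  then have "normal_family_on (- (Fin ` K)) (Q P m ` {m..})"
    by (rule normal_family_on_of_uniform_limit)
  moreover have "Q P m ` {m..} = {Q P m n | n. m \<le> n}" by auto
  ultimately have "- (Fin ` K) \<subseteq> fatou P m"
    using U unfolding fatou_def by auto
  then have "julia P m \<subseteq> Fin ` K" unfolding julia_def by blast
  with coverable_lipschitz_image[OF K Fin_lipschitz] show ?thesis
    by (rule coverable_mono) simp
qed

lemma hausdorff_measure_julia: "hausdorff_measure 1 (julia P m) = 0"
proof (rule hausdorff_measure_1_eq_0)
  fix e :: real assume e: "e > 0"
  obtain l where l: "8 / e < sqrt 2 ^ l" using real_arch_pow[of "sqrt 2" "8 / e"] by auto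
  also have "\<dots> \<le> sqrt 2 ^ Suc l" by (intro power_increasing) auto
  finally have "8 / sqrt 2 ^ Suc l \<le> e" using e by (simp add: field_simps)
  with coverable_julia show "coverable (julia P m) e"
    by (rule coverable_mono[OF _ order_refl])
qed

end

section \<open>The dimension bound\<close>

theorem theorem1p7:
  fixes c :: "nat \<Rightarrow> complex" and ms :: "nat \<Rightarrow> nat" and P :: "nat \<Rightarrow> complex poly"
  assumes "\<And>k. k \<ge> 1 \<Longrightarrow> cmod (c k) > 4"
    and "\<And>k. k \<ge> 1 \<Longrightarrow> ms k > 0"
    and "\<And>k. k \<ge> 1 \<Longrightarrow> (2::real) ^ (2 ^ ms k) \<ge> 2 * sqrt (cmod (c k))"
    and "associated_sequence c ms P"
  shows "\<forall>m. hausdorff_dim (julia P m) \<le> 1"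
proof
  fix m
  interpret associated c ms P using assms by unfold_locales
  show "hausdorff_dim (julia P m) \<le> 1"
    unfolding hausdorff_dim_def
    using hausdorff_measure_julia[of m] by (intro INF_lower2[of 1]) auto
qed

end
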